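(* Let $H$ be an $\mathbb O$-Hilbert space and let $H^*$ be the set of continuous $\mathbb O$-para-linear functions $f:H\to\mathbb O$, with right scalar multiplication $(f\odot p)(x):=f(x)p-[p,x,f]$ and norm $\|f\|=\sup_{\|x\|\le1}|f(x)|$. Then $H^*$ is a Banach right $\mathbb O$-module; that is, $H^*$ is a right $\mathbb O$-module (in particular $f\odot p\in H^*$ for all $f\in H^*$, $p\in\mathbb O$), $\|\cdot\|$ is a real norm on $H^*$ satisfying $\|f\odot p\|=\|f\|\,|p|$ for all $f\in H^*$ and $p\in\mathbb O$, and $H^*$ is complete with respect to this norm.
   Context: $\mathbb O$ denotes the octonions, with conjugation $\overline{\,\cdot\,}$, norm $|\cdot|$ and real part $\mathrm{Re}$. A left $\mathbb O$-module is a real vector space $M$ with an $\mathbb R$-bilinear scalar multiplication $\mathbb O\times M\to M$, $1m=m$, such that $r(rm)=r^2m$ for all $r\in\mathbb O$, $m\in M$ (equivalently, $[p,q,m]:=(pq)m-p(qm)$ satisfies $[p,q,m]=-[q,p,m]$). Right $\mathbb O$-modules are defined symmetrically by $(mr)r=mr^2$. For a real linear $f:M\to\mathbb O$ put $[p,x,f]:=f(px)-pf(x)$ ($p\in\mathbb O$, $x\in M$). The map $f$ is $\mathbb O$-para-linear if $\mathrm{Re}\,[p,x,f]=0$ for all $p,x$. A pre-Hilbert left $\mathbb O$-module is a left $\mathbb O$-module $H$ with an $\mathbb R$-bilinear map $\langle\cdot,\cdot\rangle:H\times H\to\mathbb O$ such that: (1) $\langle\cdot,u\rangle$ is $\mathbb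 O$-para-linear for all $u\in H$; (2) $\langle u,v\rangle=\overline{\langle v,u\rangle}$; (3) $\langle u,u\rangle$ is a nonnegative real number, equal to $0$ iff $u=0$. An $\mathbb O$-Hilbert space is a pre-Hilbert left $\mathbb O$-module complete with respect to $\|u\|=\sqrt{\langle u,u\rangle}$. *)

theory Defs
  imports "HOL-Analysis.Analysis" "HOL-Library.Function_Algebras"
begin

section \<open>Octonions\<close>

text \<open>Both types are real vector spaces and, with the library norm of product types, Euclidean
  spaces, so that \<^const>\<open>norm\<close> is the usual modulus. The products are those of the
  Cayley--Dickson construction, \<open>(a, b) (c, d) = (a c - d\<^sup>* b, d a + b c\<^sup>*)\<close>, applied to
  the complex numbers and then to the quaternions.\<close>

type_synonym quaternion = "complex \<times> complex"
type_synonym octonion = "quaternion \<times> quaternion"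

definition quat_cnj :: "quaternion \<Rightarrow> quaternion" where
  "quat_cnj x = (cnj (fst x), - snd x)"

definition quat_mult :: "quaternion \<Rightarrow> quaternion \<Rightarrow> quaternion" where
  "quat_mult x y =
     (fst x * fst y - cnj (snd y) * snd x, snd y * fst x + snd x * cnj (fst y))"

definition oct_cnj :: "octonion \<Rightarrow> octonion" where
  "oct_cnj x = (quat_cnj (fst x), - snd x)"

definition oct_mult :: "octonion \<Rightarrow> octonion \<Rightarrow> octonion"  (infixl "\<cdot>\<^sub>O" 70) where
  "x \<cdot>\<^sub>O y =
     (quat_mult (fst x) (fst y) - quat_mult (quat_cnj (snd y)) (snd x),
      quat_mult (snd y) (fst x) + quat_mult (snd x) (quat_cnj (fst y)))"

definition oct_one :: octonion  ("\<one>\<^sub>O") where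
  "\<one>\<^sub>O = ((1, 0), (0, 0))"

definition oct_Re :: "octonion \<Rightarrow> real" where
  "oct_Re x = Re (fst (fst x))"

text \<open>The product makes this an alternative composition algebra for the Euclidean norm.\<close>

lemma oct_left_alternative: "p \<cdot>\<^sub>O (p \<cdot>\<^sub>O q) = (p \<cdot>\<^sub>O p) \<cdot>\<^sub>O q"
  and oct_right_alternative: "(q \<cdot>\<^sub>O p) \<cdot>\<^sub>O p = q \<cdot>\<^sub>O (p \<cdot>\<^sub>O p)"
  by (auto simp: oct_mult_def quat_mult_def quat_cnj_def prod_eq_iff algebra_simps complex_eq_iff)

lemma oct_norm_mult: "norm (p \<cdot>\<^sub>O q) = norm p * norm q"
proof -
  have "(norm (p \<cdot>\<^sub>O q))\<^sup>2 = (norm p)\<^sup>2 * (norm q)\<^sup>2"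
    by (simp add: oct_mult_def quat_mult_def quat_cnj_def norm_prod_def cmod_def, algebra)
  then show ?thesis
    by (metis mult_nonneg_nonneg norm_ge_zero power2_eq_iff_nonneg power_mult_distrib)
qed


section \<open>Functions as a real vector space\<close>

instantiation "fun" :: (type, real_vector) real_vector
begin

definition scaleR_fun :: "real \<Rightarrow> ('a \<Rightarrow> 'b) \<Rightarrow> 'a \<Rightarrow> 'b" where
  "scaleR_fun c f = (\<lambda>x. c *\<^sub>R f x)"

instance
  by standard (auto simp: scaleR_fun_def fun_eq_iff scaleR_add_left scaleR_add_right)

end


section \<open>Octonionic modules\<close>

locale left_octonion_module =
  fixes lmult :: "octonion \<Rightarrow> 'a::real_vector \<Rightarrow> 'a"
  assumes bilinear_lmult: "bilinear lmult"
    and lmult_one: "lmult \<one>\<^sub>O m = m"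
    and lmult_lmult: "lmult r (lmult r m) = lmult (r \<cdot>\<^sub>O r) m"

text \<open>The right modules carry an explicit underlying set, a subspace of the ambient type, because
  the dual space is not a type of its own. The real vector space structure is the ambient one.\<close>

locale right_octonion_module =
  fixes M :: "'b::real_vector set" and rmult :: "'b \<Rightarrow> octonion \<Rightarrow> 'b"
  assumes subspace_carrier: "subspace M"
    and rmult_closed: "m \<in> M \<Longrightarrow> rmult m p \<in> M"
    and rmult_add_left: "m \<in> M \<Longrightarrow> n \<in> M \<Longrightarrow> rmult (m + n) p = rmult m p + rmult n p"
    and rmult_scaleR_left: "m \<in> M \<Longrightarrow> rmult (c *\<^sub>R m) p = c *\<^sub>R rmult m p"
    and rmult_add_right: "m \<in> M \<Longrightarrow> rmult m (p + q) = rmult m p + rmult m q"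
    and rmult_scaleR_right: "m \<in> M \<Longrightarrow> rmult m (c *\<^sub>R p) = c *\<^sub>R rmult m p"
    and rmult_one: "m \<in> M \<Longrightarrow> rmult m \<one>\<^sub>O = m"
    and rmult_rmult: "m \<in> M \<Longrightarrow> rmult (rmult m r) r = rmult m (r \<cdot>\<^sub>O r)"

text \<open>Completeness is spelled out because the dual norm below is a genuine norm only on the dual
  space, not on the whole ambient function type, so that no \<^locale>\<open>Metric_space\<close> is
  available for it.\<close>

definition complete_wrt :: "'b::real_vector set \<Rightarrow> ('b \<Rightarrow> real) \<Rightarrow> bool" where
  "complete_wrt M N \<longleftrightarrow>
     (\<forall>s::nat \<Rightarrow> 'b. range s \<subseteq> M \<and> (\<forall>e>0. \<exists>K. \<forall>m\<ge>K. \<forall>n\<ge>K. N (s m - s n) < e)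
        \<longrightarrow> (\<exists>l\<in>M. (\<lambda>n. N (s n - l)) \<longlonglongrightarrow> 0))"

locale banach_right_octonion_module = right_octonion_module M rmult
  for M :: "'b::real_vector set" and rmult :: "'b \<Rightarrow> octonion \<Rightarrow> 'b" +
  fixes N :: "'b \<Rightarrow> real"
  assumes N_nonneg: "m \<in> M \<Longrightarrow> 0 \<le> N m"
    and N_eq_0: "m \<in> M \<Longrightarrow> N m = 0 \<longleftrightarrow> m = 0"
    and N_triangle: "m \<in> M \<Longrightarrow> n \<in> M \<Longrightarrow> N (m + n) \<le> N m + N n"
    and N_scaleR: "m \<in> M \<Longrightarrow> N (c *\<^sub>R m) = \<bar>c\<bar> * N m"
    and N_rmult: "m \<in> M \<Longrightarrow> N (rmult m p) = N m * norm p"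
    and N_complete: "complete_wrt M N"


section \<open>Para-linear functions and Hilbert spaces\<close>

text \<open>\<open>para_assoc lmult p x f\<close> is \<open>[p, x, f]\<close>.\<close>

definition para_assoc ::
    "(octonion \<Rightarrow> 'a \<Rightarrow> 'a) \<Rightarrow> octonion \<Rightarrow> 'a \<Rightarrow> ('a \<Rightarrow> octonion) \<Rightarrow> octonion" where
  "para_assoc lmult p x f = f (lmult p x) - p \<cdot>\<^sub>O f x"

definition para_linear ::
    "(octonion \<Rightarrow> 'a \<Rightarrow> 'a) \<Rightarrow> ('a::real_vector \<Rightarrow> octonion) \<Rightarrow> bool" where
  "para_linear lmult f \<longleftrightarrow> linear f \<and> (\<forall>p x. oct_Re (para_assoc lmult p x f) = 0)"

locale pre_Hilbert_octonion_module = left_octonion_module lmult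
  for lmult :: "octonion \<Rightarrow> 'a::real_vector \<Rightarrow> 'a" +
  fixes ip :: "'a \<Rightarrow> 'a \<Rightarrow> octonion"
  assumes bilinear_ip: "bilinear ip"
    and para_linear_ip: "para_linear lmult (\<lambda>x. ip x u)"
    and ip_cnj: "ip u v = oct_cnj (ip v u)"
    and ip_self_real: "\<exists>r\<ge>0. ip u u = r *\<^sub>R \<one>\<^sub>O"
    and ip_self_eq_0: "ip u u = 0 \<longleftrightarrow> u = 0"

text \<open>\<open>\<langle>u, u\<rangle>\<close> is a real multiple of \<open>\<one>\<^sub>O\<close>, so its real part is
  \<open>\<langle>u, u\<rangle>\<close> as a real number.\<close>

definition ip_norm :: "('a \<Rightarrow> 'a \<Rightarrow> octonion) \<Rightarrow> 'a \<Rightarrow> real" where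
  "ip_norm ip u = sqrt (oct_Re (ip u u))"

definition ip_topology :: "('a::real_vector \<Rightarrow> 'a \<Rightarrow> octonion) \<Rightarrow> 'a topology" where
  "ip_topology ip = Metric_space.mtopology UNIV (\<lambda>u v. ip_norm ip (u - v))"

locale octonion_Hilbert_space = pre_Hilbert_octonion_module lmult ip
  for lmult :: "octonion \<Rightarrow> 'a::real_vector \<Rightarrow> 'a" and ip :: "'a \<Rightarrow> 'a \<Rightarrow> octonion" +
  assumes ip_complete: "complete_wrt UNIV (ip_norm ip)"


section \<open>The dual space\<close>

definition dual_space ::
    "(octonion \<Rightarrow> 'a \<Rightarrow> 'a) \<Rightarrow> ('a::real_vector \<Rightarrow> 'a \<Rightarrow> octonion) \<Rightarrow> ('a \<Rightarrow> octonion) set" where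
  "dual_space lmult ip =
     {f. para_linear lmult f \<and> continuous_map (ip_topology ip) euclidean f}"

definition dual_rmult ::
    "(octonion \<Rightarrow> 'a \<Rightarrow> 'a) \<Rightarrow> ('a \<Rightarrow> octonion) \<Rightarrow> octonion \<Rightarrow> ('a \<Rightarrow> octonion)" where
  "dual_rmult lmult f p = (\<lambda>x. f x \<cdot>\<^sub>O p - para_assoc lmult p x f)"

definition dual_norm :: "('a \<Rightarrow> 'a \<Rightarrow> octonion) \<Rightarrow> ('a \<Rightarrow> octonion) \<Rightarrow> real" where
  "dual_norm ip f = (SUP x\<in>{x. ip_norm ip x \<le> 1}. norm (f x))"

end

theory Submission
  imports Defs
begin

text \<open>A para-linear \<open>f\<close> satisfies \<open>Re (p f(x)) = Re f(p x)\<close>, so it is determined by its real part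
  \<open>\<phi> = Re f\<close>, and \<open>f \<odot> p\<close> has the real part \<open>x \<mapsto> \<phi>(p x)\<close>. The identity
  \<open>(f \<odot> r) \<odot> r = f \<odot> r\<^sup>2\<close> thus reduces to \<open>r (r x) = r\<^sup>2 x\<close>, and para-linearity of \<open>f \<odot> p\<close> to its
  polarisation \<open>p (q x) + q (p x) = (p q + q p) x\<close>. Since \<open>p\<^sup>* (p x) = |p|\<^sup>2 x\<close>, the action scales
  the Hilbert norm, \<open>|p x| = |p| |x|\<close>; combined with \<open>|f(x)|\<^sup>2 = \<phi>(f(x)\<^sup>* x)\<close>, this lets every
  norm estimate be read off from \<open>\<phi>\<close>.\<close>

section \<open>Octonion arithmetic\<close>

lemma bilinear_oct_mult: "bilinear (\<cdot>\<^sub>O)"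
  unfolding bilinear_def
  by (auto intro!: linearI
      simp: oct_mult_def quat_mult_def quat_cnj_def prod_eq_iff complex_eq_iff
        algebra_simps)

lemmas oct_mult_simps =
  bilinear_ladd[OF bilinear_oct_mult] bilinear_radd[OF bilinear_oct_mult]
  bilinear_lmul[OF bilinear_oct_mult] bilinear_rmul[OF bilinear_oct_mult]
  bilinear_lsub[OF bilinear_oct_mult] bilinear_rsub[OF bilinear_oct_mult]
  bilinear_lzero[OF bilinear_oct_mult] bilinear_rzero[OF bilinear_oct_mult]

lemma oct_mult_one_left: "\<one>\<^sub>O \<cdot>\<^sub>O p = p"
  and oct_mult_one_right: "p \<cdot>\<^sub>O \<one>\<^sub>O = p"
  by (auto simp: oct_one_def oct_mult_def quat_mult_def quat_cnj_def prod_eq_iff)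

lemma linear_oct_Re: "linear oct_Re"
  by (auto intro!: linearI simp: oct_Re_def)

lemmas oct_Re_simps =
  linear_add[OF linear_oct_Re] linear_diff[OF linear_oct_Re]
  linear_cmul[OF linear_oct_Re] linear_0[OF linear_oct_Re]

lemma oct_Re_one: "oct_Re \<one>\<^sub>O = 1"
  by (simp add: oct_Re_def oct_one_def)

lemma oct_Re_cnj: "oct_Re (oct_cnj p) = oct_Re p"
  by (simp add: oct_Re_def oct_cnj_def quat_cnj_def)

lemma oct_cnj_cnj: "oct_cnj (oct_cnj p) = p"
  by (simp add: oct_cnj_def quat_cnj_def)

lemma oct_Re_mult_commute: "oct_Re (p \<cdot>\<^sub>O q) = oct_Re (q \<cdot>\<^sub>O p)"
  by (simp add: oct_Re_def oct_mult_def quat_mult_def quat_cnj_def algebra_simps)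

text \<open>Octonion associators are purely imaginary. Together with
  \<open>oct_Re_mult_commute\<close> this makes the real part of a triple product invariant under
  cyclic shifts.\<close>

lemma oct_Re_mult_assoc: "oct_Re (p \<cdot>\<^sub>O q \<cdot>\<^sub>O r) = oct_Re (p \<cdot>\<^sub>O (q \<cdot>\<^sub>O r))"
  by (simp add: oct_Re_def oct_mult_def quat_mult_def quat_cnj_def algebra_simps)

lemma oct_Re_mult_cnj_swap: "oct_Re (p \<cdot>\<^sub>O oct_cnj q) = oct_Re (oct_cnj p \<cdot>\<^sub>O q)"
  by (simp add: oct_Re_def oct_mult_def quat_mult_def quat_cnj_def oct_cnj_def algebra_simps)

lemma oct_Re_mult_eq_inner: "oct_Re (oct_cnj p \<cdot>\<^sub>O q) = inner p q"
  by (simp add: oct_Re_def oct_mult_def quat_mult_def quat_cnj_def oct_cnj_def inner_complex_def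
      inner_prod_def algebra_simps)

lemma oct_Re_cnj_mult_self: "oct_Re (oct_cnj p \<cdot>\<^sub>O p) = (norm p)\<^sup>2"
  by (simp only: oct_Re_mult_eq_inner power2_norm_eq_inner)

lemma norm_oct_cnj: "norm (oct_cnj p) = norm p"
  by (simp add: oct_cnj_def quat_cnj_def norm_prod_def)

lemma oct_Re_le_norm: "oct_Re p \<le> norm p"
  using complex_Re_le_cmod[of "fst (fst p)"] norm_fst_le[of "fst (fst p)" "snd (fst p)"]
    norm_fst_le[of "fst p" "snd p"]
  by (simp add: oct_Re_def)

text \<open>Conjugation is written through \<open>p\<close> and the unit, so that it can be pushed
  through a linear module action.\<close>

lemma oct_cnj_eq: "oct_cnj p = (2 * oct_Re p) *\<^sub>R \<one>\<^sub>O - p"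
  by (simp add: oct_cnj_def quat_cnj_def oct_Re_def oct_one_def prod_eq_iff complex_eq_iff)

text \<open>This is the quadratic equation of \<open>p\<close>, with trace
  \<open>2 * oct_Re p\<close> and norm form \<open>(norm p)\<^sup>2\<close>.\<close>

lemma oct_mult_self: "p \<cdot>\<^sub>O p = (2 * oct_Re p) *\<^sub>R p - (norm p)\<^sup>2 *\<^sub>R \<one>\<^sub>O"
  by (auto simp: oct_mult_def quat_mult_def quat_cnj_def oct_Re_def oct_one_def prod_eq_iff
      complex_eq_iff norm_prod_def cmod_def algebra_simps power2_eq_square)


section \<open>Para-linear functions\<close>

lemma para_linearD:
  assumes "para_linear lmult f"
  shows "linear f" and "oct_Re (f (lmult p x)) = oct_Re (p \<cdot>\<^sub>O f x)"
  using assms unfolding para_linear_def para_assoc_def oct_Re_simps right_minus_eq by blast+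

lemma para_linearI:
  assumes "linear f" and "\<And>p x. oct_Re (f (lmult p x)) = oct_Re (p \<cdot>\<^sub>O f x)"
  shows "para_linear lmult f"
  using assms by (simp add: para_linear_def para_assoc_def oct_Re_simps)

text \<open>Para-linearity is applied with the scalar \<open>oct_cnj (f x)\<close>, which turns the
  product with \<open>f x\<close> into its squared modulus.\<close>

lemma para_linear_norm_square:
  assumes "para_linear lmult f"
  shows "(norm (f x))\<^sup>2 = oct_Re (f (lmult (oct_cnj (f x)) x))"
  using para_linearD(2)[OF assms] by (simp add: oct_Re_cnj_mult_self)

lemma para_linear_zero: "para_linear lmult 0"
  by (auto intro!: para_linearI linearI simp: oct_mult_simps)

lemma para_linear_add:
  assumes "para_linear lmult f" "para_linear lmult g"
  shows "para_linear lmult (f + g)"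
  using assms[THEN para_linearD(1)] assms[THEN para_linearD(2)]
  by (auto intro!: para_linearI linear_compose_add simp: plus_fun_def oct_mult_simps oct_Re_simps)

lemma para_linear_scaleR:
  assumes "para_linear lmult f"
  shows "para_linear lmult (c *\<^sub>R f)"
  using assms[THEN para_linearD(1)] assms[THEN para_linearD(2)]
  by (auto intro!: para_linearI linear_compose_scale_right
      simp: scaleR_fun_def oct_mult_simps oct_Re_simps)

lemma para_linear_diff:
  assumes "para_linear lmult f" "para_linear lmult g"
  shows "para_linear lmult (f - g)"
  using para_linear_add[OF assms(1) para_linear_scaleR[OF assms(2), of "- 1"]]
  by simp

text \<open>The difference is para-linear with vanishing real part, and its squared modulus at a
  point is its real part at another point.\<close>

lemma para_linear_eqI:
  assumes f: "para_linear lmult f" and g: "para_linear lmult g"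
    and Re: "\<And>x. oct_Re (f x) = oct_Re (g x)"
  shows "f = g"
proof
  fix x
  have "(norm ((f - g) x))\<^sup>2 = 0"
    unfolding para_linear_norm_square[OF para_linear_diff[OF f g]] by (simp add: oct_Re_simps Re)
  then show "f x = g x" by simp
qed

text \<open>Linearity and the real-part identity are equations between continuous expressions in the
  values of the function, so they survive pointwise limits.\<close>

lemma para_linear_tendsto:
  assumes s: "\<And>n. para_linear lmult (s n)" and lim: "\<And>x. (\<lambda>n. s n x) \<longlonglongrightarrow> f x"
  shows "para_linear lmult f"
proof (rule para_linearI)
  note lin = s[THEN para_linearD(1)]
  show "linear f"
  proof
    show "f (x + y) = f x + f y" for x y
      using LIMSEQ_unique[OF lim[of "x + y"]] tendsto_add[OF lim[of x] lim[of y]]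
      by (simp add: linear_add[OF lin])
    show "f (c *\<^sub>R x) = c *\<^sub>R f x" for c x
      using LIMSEQ_unique[OF lim[of "c *\<^sub>R x"]] tendsto_scaleR[OF tendsto_const lim[of x]]
      by (simp add: linear_cmul[OF lin])
  qed
next
  fix p x
  \<comment> \<open>Linear maps on the finite-dimensional space of octonions are bounded, hence
    commute with limits.\<close>
  have "linear (\<lambda>y. oct_Re (p \<cdot>\<^sub>O y))"
    by (intro linearI) (simp_all add: oct_mult_simps oct_Re_simps)
  then have "(\<lambda>n. oct_Re (p \<cdot>\<^sub>O s n x)) \<longlonglongrightarrow> oct_Re (p \<cdot>\<^sub>O f x)"
    using lim
    by (rule bounded_linear.tendsto[OF linear_conv_bounded_linear[THEN iffD1]])
  moreover have "(\<lambda>n. oct_Re (s n (lmult p x))) \<longlonglongrightarrow> oct_Re (f (lmult p x))"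
    using linear_oct_Re lim
    by (rule bounded_linear.tendsto[OF linear_conv_bounded_linear[THEN iffD1]])
  ultimately show "oct_Re (f (lmult p x)) = oct_Re (p \<cdot>\<^sub>O f x)"
    using LIMSEQ_unique by (simp add: para_linearD(2)[OF s])
qed

section \<open>The right action on para-linear functions\<close>

context left_octonion_module
begin

lemmas lmult_simps =
  bilinear_ladd[OF bilinear_lmult] bilinear_radd[OF bilinear_lmult]
  bilinear_lmul[OF bilinear_lmult] bilinear_rmul[OF bilinear_lmult]
  bilinear_lsub[OF bilinear_lmult] bilinear_rsub[OF bilinear_lmult]

text \<open>Expanding the square law at \<open>p + q\<close> and cancelling the pure squares leaves
  the mixed terms.\<close>

lemma lmult_polarised:
  "lmult p (lmult q x) + lmult q (lmult p x) = lmult (p \<cdot>\<^sub>O q) x + lmult (q \<cdot>\<^sub>O p) x"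
  using lmult_lmult[of "p + q" x] lmult_lmult[of p x] lmult_lmult[of q x]
  by (simp add: lmult_simps oct_mult_simps algebra_simps)

text \<open>Since \<open>oct_cnj p\<close> is a real combination of the unit and \<open>p\<close>,
  the action involves only \<open>p (p x) = (p p) x\<close>; the quadratic equation of
  \<open>p\<close> then cancels everything but the norm term.\<close>

lemma lmult_cnj_lmult: "lmult (oct_cnj p) (lmult p x) = (norm p)\<^sup>2 *\<^sub>R x"
  by (simp add: oct_cnj_eq lmult_simps lmult_one lmult_lmult oct_mult_self)

lemma lmult_lmult_cnj: "lmult p (lmult (oct_cnj p) x) = (norm p)\<^sup>2 *\<^sub>R x"
  using lmult_cnj_lmult[of "oct_cnj p" x] by (simp add: oct_cnj_cnj norm_oct_cnj)

text \<open>The subtracted associator is purely imaginary, and real parts of products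
  commute.\<close>

lemma oct_Re_dual_rmult:
  assumes "para_linear lmult f"
  shows "oct_Re (dual_rmult lmult f p x) = oct_Re (f (lmult p x))"
  using para_linearD(2)[OF assms]
  by (simp add: dual_rmult_def para_assoc_def oct_Re_simps oct_Re_mult_commute)

lemma para_linear_dual_rmult:
  assumes "para_linear lmult f"
  shows "para_linear lmult (dual_rmult lmult f p)"
proof (rule para_linearI)
  note lin = para_linearD(1)[OF assms] and Re = para_linearD(2)[OF assms]
  show "linear (dual_rmult lmult f p)"
    by (auto intro!: linearI simp: dual_rmult_def para_assoc_def lmult_simps oct_mult_simps
        linear_add[OF lin] linear_cmul[OF lin] algebra_simps)
  fix q x
  have "oct_Re (dual_rmult lmult f p (lmult q x)) = oct_Re (f (lmult p (lmult q x)))"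
    by (rule oct_Re_dual_rmult[OF assms])
  \<comment> \<open>The module is not associative, so \<open>p (q x)\<close> is accessible only
    through the symmetrised law.\<close>
  also have "lmult p (lmult q x)
      = lmult (p \<cdot>\<^sub>O q) x + lmult (q \<cdot>\<^sub>O p) x - lmult q (lmult p x)"
    using lmult_polarised[of p q x] by (simp add: algebra_simps)
  also have "oct_Re (f \<dots>) = oct_Re (p \<cdot>\<^sub>O q \<cdot>\<^sub>O f x) + oct_Re (q \<cdot>\<^sub>O p \<cdot>\<^sub>O f x)
      - oct_Re (q \<cdot>\<^sub>O f (lmult p x))"
    by (simp add: linear_add[OF lin] linear_diff[OF lin] oct_Re_simps Re)
  \<comment> \<open>A cyclic shift moves \<open>p\<close> to the right of \<open>f x\<close>, where
    it forms the leading term of the right action.\<close>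
  also have "oct_Re (p \<cdot>\<^sub>O q \<cdot>\<^sub>O f x) = oct_Re (q \<cdot>\<^sub>O (f x \<cdot>\<^sub>O p))"
    by (metis oct_Re_mult_assoc oct_Re_mult_commute)
  also have "oct_Re (q \<cdot>\<^sub>O (f x \<cdot>\<^sub>O p)) + oct_Re (q \<cdot>\<^sub>O p \<cdot>\<^sub>O f x) - oct_Re (q \<cdot>\<^sub>O f (lmult p x))
      = oct_Re (q \<cdot>\<^sub>O dual_rmult lmult f p x)"
    by (simp add: dual_rmult_def para_assoc_def oct_mult_simps oct_Re_simps oct_Re_mult_assoc)
  finally show "oct_Re (dual_rmult lmult f p (lmult q x)) = oct_Re (q \<cdot>\<^sub>O dual_rmult lmult f p x)" .
qed

lemma dual_rmult_dual_rmult: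
  assumes "para_linear lmult f"
  shows "dual_rmult lmult (dual_rmult lmult f r) r = dual_rmult lmult f (r \<cdot>\<^sub>O r)"
  using assms
  by (intro para_linear_eqI[where lmult = lmult] para_linear_dual_rmult)
    (simp_all add: oct_Re_dual_rmult para_linear_dual_rmult lmult_lmult)

end


section \<open>The norm of a pre-Hilbert module\<close>

context pre_Hilbert_octonion_module
begin

lemmas ip_simps =
  bilinear_ladd[OF bilinear_ip] bilinear_radd[OF bilinear_ip]
  bilinear_lmul[OF bilinear_ip] bilinear_rmul[OF bilinear_ip]
  bilinear_lsub[OF bilinear_ip] bilinear_rsub[OF bilinear_ip]

lemma Re_ip_commute: "oct_Re (ip u v) = oct_Re (ip v u)"
  by (metis ip_cnj oct_Re_cnj)

lemma Re_ip_self_nonneg: "0 \<le> oct_Re (ip u u)"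
  using ip_self_real[of u] by (auto simp: oct_Re_simps oct_Re_one)

lemma Re_ip_self_eq_0: "oct_Re (ip u u) = 0 \<longleftrightarrow> u = 0"
  using ip_self_real[of u] ip_self_eq_0[of u] by (auto simp: oct_Re_simps oct_Re_one)

lemma ip_norm_nonneg: "0 \<le> ip_norm ip u"
  by (simp add: ip_norm_def Re_ip_self_nonneg)

lemma ip_norm_square: "(ip_norm ip u)\<^sup>2 = oct_Re (ip u u)"
  by (simp add: ip_norm_def Re_ip_self_nonneg)

lemma ip_norm_eq_0: "ip_norm ip u = 0 \<longleftrightarrow> u = 0"
  by (simp add: ip_norm_def Re_ip_self_eq_0)

lemma ip_norm_scaleR: "ip_norm ip (c *\<^sub>R u) = \<bar>c\<bar> * ip_norm ip u"
  by (simp add: ip_norm_def ip_simps oct_Re_simps real_sqrt_mult flip: mult.assoc)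

text \<open>Para-linearity takes \<open>p\<close> out of the first argument, Hermitian symmetry
  exchanges the arguments, and para-linearity reinserts it as \<open>oct_cnj p\<close>; then
  \<open>lmult_cnj_lmult\<close> applies.\<close>

lemma ip_norm_lmult: "ip_norm ip (lmult p x) = norm p * ip_norm ip x"
proof -
  note Re = para_linearD(2)[OF para_linear_ip]
  have "(ip_norm ip (lmult p x))\<^sup>2 = oct_Re (p \<cdot>\<^sub>O oct_cnj (ip (lmult p x) x))"
    by (simp add: ip_norm_square Re flip: ip_cnj)
  also have "\<dots> = oct_Re (ip (lmult (oct_cnj p) (lmult p x)) x)"
    by (simp add: Re oct_Re_mult_cnj_swap)
  also have "\<dots> = (norm p * ip_norm ip x)\<^sup>2"
    by (simp add: lmult_cnj_lmult ip_simps oct_Re_simps power_mult_distrib ip_norm_square)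
  finally show ?thesis
    by (simp add: power2_eq_iff_nonneg ip_norm_nonneg)
qed

text \<open>Cauchy-Schwarz for the real inner product \<open>oct_Re (ip u v)\<close>: two vectors
  rescaled to the common norm \<open>a * b\<close> have a difference of nonnegative square.\<close>

lemma Re_ip_le: "oct_Re (ip u v) \<le> ip_norm ip u * ip_norm ip v"
proof (cases "u = 0 \<or> v = 0")
  case True
  then show ?thesis
    using bilinear_lzero[OF bilinear_ip] bilinear_rzero[OF bilinear_ip]
    by (auto simp: oct_Re_simps ip_norm_def)
next
  case False
  define a b where "a = ip_norm ip u" and "b = ip_norm ip v"
  have pos: "a > 0" "b > 0"
    using False ip_norm_nonneg ip_norm_eq_0 by (auto simp: a_def b_def less_le)
  have "0 \<le> oct_Re (ip (b *\<^sub>R u - a *\<^sub>R v) (b *\<^sub>R u - a *\<^sub>R v))"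
    by (rule Re_ip_self_nonneg)
  also have "\<dots> = b\<^sup>2 * a\<^sup>2 - 2 * (a * b) * oct_Re (ip u v) + a\<^sup>2 * b\<^sup>2"
    unfolding a_def b_def ip_norm_square
    by (simp add: ip_simps oct_Re_simps Re_ip_commute[of v u] power2_eq_square
        flip: ip_norm_square) (simp add: algebra_simps)
  finally have "(a * b) * oct_Re (ip u v) \<le> (a * b) * (a * b)"
    by (simp add: power2_eq_square algebra_simps)
  then show ?thesis
    using pos by (simp add: a_def b_def)
qed

lemma ip_norm_triangle: "ip_norm ip (u + v) \<le> ip_norm ip u + ip_norm ip v"
proof (rule power2_le_imp_le)
  have "(ip_norm ip (u + v))\<^sup>2
      = (ip_norm ip u)\<^sup>2 + 2 * oct_Re (ip u v) + (ip_norm ip v)\<^sup>2"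
    by (simp add: ip_norm_square ip_simps oct_Re_simps Re_ip_commute[of v u])
  then show "(ip_norm ip (u + v))\<^sup>2 \<le> (ip_norm ip u + ip_norm ip v)\<^sup>2"
    using Re_ip_le[of u v] by (simp add: power2_sum)
qed (simp add: ip_norm_nonneg)

text \<open>This gives \<open>ip_topology\<close> its intended meaning and opens it to the facts on
  metric topologies.\<close>

sublocale ip_metric: Metric_space UNIV "\<lambda>u v. ip_norm ip (u - v)"
proof
  show "ip_norm ip (x - y) = ip_norm ip (y - x)" for x y
    using ip_norm_scaleR[of "- 1" "x - y"] by simp
  show "ip_norm ip (x - z) \<le> ip_norm ip (x - y) + ip_norm ip (y - z)" for x y z
    using ip_norm_triangle[of "x - y" "y - z"] by simp
qed (auto simp: ip_norm_nonneg ip_norm_eq_0)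


section \<open>The dual space\<close>

lemma continuous_linear_iff_bounded:
  fixes f :: "'a \<Rightarrow> octonion"
  assumes lin: "linear f"
  shows "continuous_map (ip_topology ip) euclidean f
    \<longleftrightarrow> (\<exists>B\<ge>0. \<forall>x. norm (f x) \<le> B * ip_norm ip x)"
proof
  assume "continuous_map (ip_topology ip) euclidean f"
  then have "openin ip_metric.mtopology {x. f x \<in> ball 0 1}"
    using openin_continuous_map_preimage[of _ euclidean f "ball 0 1"]
    by (fastforce simp: ip_topology_def)
  moreover have "0 \<in> {x. f x \<in> ball 0 1}"
    by (simp add: linear_0[OF lin])
  ultimately obtain r where r: "r > 0" "ip_metric.mball 0 r \<subseteq> {x. f x \<in> ball 0 1}"
    unfolding ip_metric.openin_mtopology by blast
  \<comment> \<open>Balls around \<open>0\<close> measure \<open>0 - x\<close>, so symmetry of the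
    metric is needed to speak of \<open>ip_norm ip x\<close>.\<close>
  have small: "norm (f x) < 1" if "ip_norm ip x < r" for x
  proof -
    have "ip_norm ip (0 - x) < r"
      using that by (subst ip_metric.commute) simp
    then show ?thesis
      using r(2) by (auto simp: subset_iff)
  qed
  have "norm (f x) \<le> 2 / r * ip_norm ip x" for x
  proof (cases "x = 0")
    case True
    then show ?thesis
      using r(1) ip_norm_nonneg by (simp add: linear_0[OF lin])
  next
    case False
    then have pos: "ip_norm ip x > 0"
      using ip_norm_nonneg[of x] ip_norm_eq_0[of x] by linarith
    \<comment> \<open>This factor brings \<open>x\<close> to norm \<open>r / 2\<close>, strictly
      inside the ball.\<close>
    define c where "c = r / (2 * ip_norm ip x)"
    have "c > 0" using r(1) pos by (simp add: c_def)
    moreover have "ip_norm ip (c *\<^sub>R x) < r"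
      using r(1) pos by (simp add: ip_norm_scaleR c_def)
    ultimately have "c * norm (f x) < 1"
      using small[of "c *\<^sub>R x"] by (simp add: linear_cmul[OF lin])
    then show ?thesis
      using r(1) pos by (simp add: c_def field_simps)
  qed
  then show "\<exists>B\<ge>0. \<forall>x. norm (f x) \<le> B * ip_norm ip x"
    using r(1) by (intro exI[of _ "2 / r"]) simp
next
  assume "\<exists>B\<ge>0. \<forall>x. norm (f x) \<le> B * ip_norm ip x"
  then obtain B where B: "B \<ge> 0" "\<And>x. norm (f x) \<le> B * ip_norm ip x" by blast
  have "continuous_map ip_metric.mtopology Met_TC.mtopology f"
    unfolding ip_metric.metric_continuous_map[OF Met_TC.Metric_space_axioms]
  proof (intro conjI ballI allI impI)
    fix a :: 'a and e :: real
    assume "0 < e"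
    show "\<exists>d>0. \<forall>x. x \<in> UNIV \<and> ip_norm ip (a - x) < d \<longrightarrow> dist (f a) (f x) < e"
    \<comment> \<open>The summand 1 keeps the denominator positive when \<open>B\<close> is
      0.\<close>
    proof (intro exI[of _ "e / (B + 1)"] conjI allI impI)
      show "0 < e / (B + 1)" using \<open>0 < e\<close> B(1) by simp
      fix x assume "x \<in> UNIV \<and> ip_norm ip (a - x) < e / (B + 1)"
      then have "(B + 1) * ip_norm ip (a - x) < e"
        using B(1) by (simp add: field_simps)
      moreover have "dist (f a) (f x) \<le> B * ip_norm ip (a - x)"
        using B(2)[of "a - x"] by (simp add: dist_norm linear_diff[OF lin])
      ultimately show "dist (f a) (f x) < e"
        using ip_norm_nonneg[of "a - x"] by (simp only: distrib_right mult_1)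
    qed
  qed simp
  then show "continuous_map (ip_topology ip) euclidean f"
    by (simp add: ip_topology_def)
qed

abbreviation "dual \<equiv> dual_space lmult ip"

lemma dual_iff:
  "f \<in> dual \<longleftrightarrow> para_linear lmult f \<and> (\<exists>B\<ge>0. \<forall>x. norm (f x) \<le> B * ip_norm ip x)"
  using continuous_linear_iff_bounded by (auto simp: dual_space_def dest: para_linearD(1))

lemma dual_para_linear: "f \<in> dual \<Longrightarrow> para_linear lmult f"
  by (simp add: dual_iff)

section \<open>The dual norm on the space of dual functions\<close>

text \<open>The supremum of an unbounded set of reals carries no information, so each upper estimate
  by \<open>dual_norm\<close> rests on this bound.\<close>

lemma bdd_above_dual:
  assumes "f \<in> dual"
  shows "bdd_above ((\<lambda>x. norm (f x)) ` {x. ip_norm ip x \<le> 1})"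
proof -
  obtain B where "B \<ge> 0" and B: "\<And>x. norm (f x) \<le> B * ip_norm ip x"
    using assms by (auto simp: dual_iff)
  have "norm (f x) \<le> B" if "ip_norm ip x \<le> 1" for x
    using B[of x] mult_left_mono[OF that \<open>B \<ge> 0\<close>] by linarith
  then show ?thesis by (auto intro!: bdd_aboveI2)
qed

lemma dual_norm_nonneg:
  assumes "f \<in> dual"
  shows "0 \<le> dual_norm ip f"
  unfolding dual_norm_def
  by (rule cSUP_upper2[OF bdd_above_dual[OF assms], of 0]) (simp_all add: ip_norm_def oct_Re_simps
      bilinear_lzero[OF bilinear_ip])

text \<open>Normalising \<open>x\<close> to a unit vector brings it into the index set of the
  supremum; linearity restores the factor.\<close>

lemma norm_le_dual_norm:
  assumes f: "f \<in> dual"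
  shows "norm (f x) \<le> dual_norm ip f * ip_norm ip x"
proof (cases "x = 0")
  case True
  then show ?thesis
    using linear_0[OF para_linearD(1)[OF dual_para_linear[OF f]]] ip_norm_eq_0[of 0] by simp
next
  case False
  then have pos: "ip_norm ip x > 0"
    using ip_norm_nonneg[of x] ip_norm_eq_0[of x] by linarith
  define y where "y = (1 / ip_norm ip x) *\<^sub>R x"
  have "ip_norm ip y \<le> 1"
    using pos by (simp add: y_def ip_norm_scaleR)
  then have "norm (f y) \<le> dual_norm ip f"
    unfolding dual_norm_def by (intro cSUP_upper bdd_above_dual[OF f]) simp
  then show ?thesis
    using pos linear_cmul[OF para_linearD(1)[OF dual_para_linear[OF f]]]
    by (simp add: y_def field_simps)
qed

lemma dual_norm_le:
  assumes "\<And>x. norm (f x) \<le> B * ip_norm ip x" "B \<ge> 0"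
  shows "dual_norm ip f \<le> B"
  unfolding dual_norm_def
proof (rule cSUP_least)
  show "{x. ip_norm ip x \<le> 1} \<noteq> {}"
    using ip_norm_eq_0[of 0] by (auto intro!: exI[of _ 0])
  show "norm (f x) \<le> B" if "x \<in> {x. ip_norm ip x \<le> 1}" for x
    using assms(1)[of x] mult_left_mono[of "ip_norm ip x" 1 B] that assms(2) by simp
qed

lemma zero_in_dual: "0 \<in> dual"
  by (auto simp: dual_iff para_linear_zero)

text \<open>This single estimate serves both closure of the dual under addition and the triangle
  inequality.\<close>

lemma norm_add_le_dual:
  assumes "f \<in> dual" "g \<in> dual"
  shows "norm ((f + g) x) \<le> (dual_norm ip f + dual_norm ip g) * ip_norm ip x"
  using norm_triangle_ineq[of "f x" "g x"] norm_le_dual_norm[OF assms(1), of x]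
    norm_le_dual_norm[OF assms(2), of x]
  by (simp add: distrib_right)

lemma add_in_dual:
  assumes "f \<in> dual" "g \<in> dual"
  shows "f + g \<in> dual"
  unfolding dual_iff using norm_add_le_dual[OF assms] assms[THEN dual_norm_nonneg]
  by (auto intro!: para_linear_add assms[THEN dual_para_linear]
      exI[of _ "dual_norm ip f + dual_norm ip g"])

lemma norm_scaleR_le_dual:
  assumes "f \<in> dual"
  shows "norm ((c *\<^sub>R f) x) \<le> (\<bar>c\<bar> * dual_norm ip f) * ip_norm ip x"
  using mult_left_mono[OF norm_le_dual_norm[OF assms, of x], of "\<bar>c\<bar>"]
  by (simp add: scaleR_fun_def mult.assoc)

lemma scaleR_in_dual:
  assumes "f \<in> dual"
  shows "c *\<^sub>R f \<in> dual"
  unfolding dual_iff using norm_scaleR_le_dual[OF assms, of c] dual_norm_nonneg[OF assms]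
  by (auto intro!: para_linear_scaleR dual_para_linear[OF assms] exI[of _ "\<bar>c\<bar> * dual_norm ip f"])

lemma subspace_dual: "subspace dual"
  by (simp add: subspace_def zero_in_dual add_in_dual scaleR_in_dual)

lemma dual_norm_scaleR_le:
  assumes "f \<in> dual"
  shows "dual_norm ip (c *\<^sub>R f) \<le> \<bar>c\<bar> * dual_norm ip f"
  using norm_scaleR_le_dual[OF assms] dual_norm_nonneg[OF assms] by (intro dual_norm_le) auto

lemma dual_norm_scaleR:
  assumes f: "f \<in> dual"
  shows "dual_norm ip (c *\<^sub>R f) = \<bar>c\<bar> * dual_norm ip f"
proof (cases "c = 0")
  case True
  then show ?thesis
    using dual_norm_scaleR_le[OF f, of c] dual_norm_nonneg[OF scaleR_in_dual[OF f, of c]] by simp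
next
  case False
  \<comment> \<open>The reverse inequality is the upper estimate for the scalar
    \<open>inverse c\<close> and the function \<open>c *\<^sub>R f\<close>.\<close>
  then have "\<bar>c\<bar> * dual_norm ip f \<le> dual_norm ip (c *\<^sub>R f)"
    using dual_norm_scaleR_le[OF scaleR_in_dual[OF f, of c], of "inverse c"]
    by (simp add: field_simps abs_divide)
  then show ?thesis
    using dual_norm_scaleR_le[OF f, of c] by simp
qed

lemma dual_norm_eq_0:
  assumes "f \<in> dual"
  shows "dual_norm ip f = 0 \<longleftrightarrow> f = 0"
proof
  assume "dual_norm ip f = 0"
  then show "f = 0"
    using norm_le_dual_norm[OF assms] by (simp add: fun_eq_iff)
next
  assume "f = 0"
  then show "dual_norm ip f = 0"
    using dual_norm_scaleR[OF zero_in_dual, of 0] by simp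
qed

section \<open>The dual norm under the right action\<close>

text \<open>The vector \<open>lmult (oct_cnj (g x)) x\<close> has norm
  \<open>norm (g x) * ip_norm ip x\<close>, and the real part of \<open>g\<close> there is
  \<open>(norm (g x))\<^sup>2\<close>; cancelling one factor upgrades a bound on real parts to one
  on moduli.\<close>

lemma para_linear_bound:
  assumes g: "para_linear lmult g" and B: "\<And>z. oct_Re (g z) \<le> B * ip_norm ip z" "B \<ge> 0"
  shows "norm (g x) \<le> B * ip_norm ip x"
proof (cases "g x = 0")
  case True
  then show ?thesis using B(2) ip_norm_nonneg by simp
next
  case False
  have "(norm (g x))\<^sup>2 \<le> B * ip_norm ip (lmult (oct_cnj (g x)) x)"
    unfolding para_linear_norm_square[OF g] by (rule B(1))
  then have "norm (g x) * norm (g x) \<le> norm (g x) * (B * ip_norm ip x)"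
    by (simp add: ip_norm_lmult norm_oct_cnj power2_eq_square algebra_simps)
  then show ?thesis using False by simp
qed

lemma norm_dual_rmult_le:
  assumes f: "f \<in> dual"
  shows "norm (dual_rmult lmult f p x) \<le> (dual_norm ip f * norm p) * ip_norm ip x"
proof (rule para_linear_bound)
  note pf = dual_para_linear[OF f]
  show "para_linear lmult (dual_rmult lmult f p)"
    by (rule para_linear_dual_rmult[OF pf])
  show "oct_Re (dual_rmult lmult f p z) \<le> dual_norm ip f * norm p * ip_norm ip z" for z
    using oct_Re_le_norm[of "f (lmult p z)"] norm_le_dual_norm[OF f, of "lmult p z"]
    by (simp add: oct_Re_dual_rmult[OF pf] ip_norm_lmult mult.assoc)
qed (simp add: dual_norm_nonneg[OF f])

lemma dual_rmult_in_dual: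
  assumes "f \<in> dual"
  shows "dual_rmult lmult f p \<in> dual"
  unfolding dual_iff using norm_dual_rmult_le[OF assms, of p] dual_norm_nonneg[OF assms]
  by (auto intro!: para_linear_dual_rmult dual_para_linear[OF assms]
      exI[of _ "dual_norm ip f * norm p"])

lemma dual_norm_dual_rmult:
  assumes f: "f \<in> dual"
  shows "dual_norm ip (dual_rmult lmult f p) = dual_norm ip f * norm p"
proof (rule antisym)
  let ?g = "dual_rmult lmult f p"
  note pf = dual_para_linear[OF f] and g = dual_rmult_in_dual[OF f, of p]
  show "dual_norm ip ?g \<le> dual_norm ip f * norm p"
    using norm_dual_rmult_le[OF f] dual_norm_nonneg[OF f] by (intro dual_norm_le) auto
  show "dual_norm ip f * norm p \<le> dual_norm ip ?g"
  proof (cases "p = 0")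
    case True
    then show ?thesis using dual_norm_nonneg[OF g] by simp
  next
    case False
    have "oct_Re (f z) \<le> (dual_norm ip ?g / norm p) * ip_norm ip z" for z
    proof -
      \<comment> \<open>Up to the factor \<open>(norm p)\<^sup>2\<close>, \<open>z\<close> is
        \<open>p\<close> acting on \<open>lmult (oct_cnj p) z\<close>, so values of \<open>f\<close>
        are recovered from those of \<open>?g\<close>.\<close>
      have "(norm p)\<^sup>2 * oct_Re (f z) = oct_Re (f (lmult p (lmult (oct_cnj p) z)))"
        by (simp add: lmult_lmult_cnj linear_cmul[OF para_linearD(1)[OF pf]] oct_Re_simps)
      also have "\<dots> = oct_Re (?g (lmult (oct_cnj p) z))"
        by (simp add: oct_Re_dual_rmult[OF pf])
      also have "\<dots> \<le> dual_norm ip ?g * ip_norm ip (lmult (oct_cnj p) z)"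
        using oct_Re_le_norm norm_le_dual_norm[OF g] by (rule order_trans)
      finally show ?thesis
        using False by (simp add: ip_norm_lmult norm_oct_cnj power2_eq_square field_simps)
    qed
    then have "dual_norm ip f \<le> dual_norm ip ?g / norm p"
      using dual_norm_nonneg[OF g] by (intro dual_norm_le para_linear_bound[OF pf]) auto
    then show ?thesis using False by (simp add: field_simps)
  qed
qed

section \<open>Completeness of the dual\<close>

text \<open>Octonions being complete, a Cauchy sequence converges pointwise to a para-linear
  function; estimates uniform relative to \<open>ip_norm ip x\<close> give its boundedness and
  convergence in norm.\<close>

lemma complete_dual: "complete_wrt dual (dual_norm ip)"
  unfolding complete_wrt_def
proof (intro allI impI)
  fix s :: "nat \<Rightarrow> 'a \<Rightarrow> octonion"
  assume *: "range s \<subseteq> dual \<and> (\<forall>e>0. \<exists>K. \<forall>m\<ge>K. \<forall>n\<ge>K. dual_norm ip (s m - s n) < e)"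
  then have s: "s n \<in> dual" for n by (blast intro: rangeI)
  have Cauchy: "\<exists>K. \<forall>m\<ge>K. \<forall>n\<ge>K. dual_norm ip (s m - s n) < e" if "e > 0" for e
    using * that by blast
  have diff: "f - g \<in> dual" if "f \<in> dual" "g \<in> dual" for f g
    using subspace_diff[OF subspace_dual that] .
  have bound: "\<exists>K. \<forall>m\<ge>K. \<forall>n\<ge>K. \<forall>x. norm (s m x - s n x) \<le> e * ip_norm ip x"
    if "e > 0" for e
  proof -
    obtain K where K: "\<And>m n. m \<ge> K \<Longrightarrow> n \<ge> K \<Longrightarrow> dual_norm ip (s m - s n) < e"
      using Cauchy[OF \<open>e > 0\<close>] by blast
    have "norm (s m x - s n x) \<le> e * ip_norm ip x" if "m \<ge> K" "n \<ge> K" for m n x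
    proof -
      have "norm ((s m - s n) x) \<le> dual_norm ip (s m - s n) * ip_norm ip x"
        by (rule norm_le_dual_norm[OF diff[OF s s]])
      also have "\<dots> \<le> e * ip_norm ip x"
        by (rule mult_right_mono[OF less_imp_le[OF K[OF that]] ip_norm_nonneg])
      finally show ?thesis by simp
    qed
    then show ?thesis by blast
  qed
  have "Cauchy (\<lambda>n. s n x)" for x
  proof (rule metric_CauchyI)
    fix e :: real assume "e > 0"
    \<comment> \<open>Adding 1 avoids division by zero at \<open>x = 0\<close> and makes the later
      bound strict.\<close>
    define d where "d = e / (ip_norm ip x + 1)"
    have pos: "ip_norm ip x + 1 > 0" using ip_norm_nonneg[of x] by simp
    then have "d > 0" using \<open>e > 0\<close> by (simp add: d_def)
    moreover have "d * ip_norm ip x < e"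
      using pos \<open>e > 0\<close> by (simp add: d_def field_simps)
    moreover obtain K where "\<forall>m\<ge>K. \<forall>n\<ge>K. \<forall>x. norm (s m x - s n x) \<le> d * ip_norm ip x"
      using bound[OF \<open>d > 0\<close>] by blast
    ultimately show "\<exists>M. \<forall>m\<ge>M. \<forall>n\<ge>M. dist (s m x) (s n x) < e"
      unfolding dist_norm by (intro exI[of _ K]) (blast intro: le_less_trans)
  qed
  then have "convergent (\<lambda>n. s n x)" for x
    by (simp add: Cauchy_convergent_iff)
  then obtain f where f: "\<And>x. (\<lambda>n. s n x) \<longlonglongrightarrow> f x"
    unfolding convergent_LIMSEQ_iff by (rule that)
  have pf: "para_linear lmult f"
    using dual_para_linear[OF s] f by (rule para_linear_tendsto)
  \<comment> \<open>With \<open>m\<close> fixed, \<open>n\<close> tends to infinity in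
    \<open>bound\<close>; the threshold \<open>K\<close> stays independent of
    \<open>x\<close>.\<close>
  have limit: "\<exists>K. \<forall>m\<ge>K. \<forall>x. norm (s m x - f x) \<le> e * ip_norm ip x" if "e > 0" for e
  proof -
    obtain K where K:
      "\<And>m n x. m \<ge> K \<Longrightarrow> n \<ge> K \<Longrightarrow> norm (s m x - s n x) \<le> e * ip_norm ip x"
      using bound[OF \<open>e > 0\<close>] by blast
    have "norm (s m x - f x) \<le> e * ip_norm ip x" if "m \<ge> K" for m x
    proof (rule LIMSEQ_le_const2)
      show "(\<lambda>n. norm (s m x - s n x)) \<longlonglongrightarrow> norm (s m x - f x)"
        by (intro tendsto_intros f)
      show "\<exists>N. \<forall>n\<ge>N. norm (s m x - s n x) \<le> e * ip_norm ip x"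
        using K[OF that] by blast
    qed
    then show ?thesis by blast
  qed
  \<comment> \<open>One index close to the limit suffices: \<open>f\<close> is \<open>s K\<close>
    minus the bounded function \<open>s K - f\<close>.\<close>
  obtain K where K: "\<And>x. norm (s K x - f x) \<le> ip_norm ip x"
    using limit[of 1] by auto
  have "s K - f \<in> dual"
    unfolding dual_iff using K
    by (auto intro!: para_linear_diff dual_para_linear[OF s] pf exI[of _ 1])
  then have "f \<in> dual"
    using diff[OF s[of K], of "s K - f"] by simp
  moreover have "(\<lambda>n. dual_norm ip (s n - f)) \<longlonglongrightarrow> 0"
  proof (rule LIMSEQ_I)
    fix r :: real assume "r > 0"
    \<comment> \<open>Halving \<open>r\<close> compensates for the supremum yielding only a weak
      inequality.\<close>
    then obtain K where K: "\<And>m x. m \<ge> K \<Longrightarrow> norm (s m x - f x) \<le> r / 2 * ip_norm ip x"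
      using limit[of "r / 2"] by auto
    have "norm (dual_norm ip (s m - f) - 0) < r" if "m \<ge> K" for m
      using dual_norm_le[of "s m - f" "r / 2"] K[OF that] \<open>r > 0\<close>
        dual_norm_nonneg[OF diff[OF s \<open>f \<in> dual\<close>], of m]
      by simp
    then show "\<exists>K. \<forall>n\<ge>K. norm (dual_norm ip (s n - f) - 0) < r" by blast
  qed
  ultimately show "\<exists>l\<in>dual. (\<lambda>n. dual_norm ip (s n - l)) \<longlonglongrightarrow> 0" by blast
qed

lemma banach_right_octonion_module_dual:
  "banach_right_octonion_module dual (dual_rmult lmult) (dual_norm ip)"
proof
  fix f assume f: "f \<in> dual"
  note lin = para_linearD(1)[OF dual_para_linear[OF f]]
  show "dual_rmult lmult f p \<in> dual" for p
    by (rule dual_rmult_in_dual[OF f])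
  show "dual_rmult lmult (c *\<^sub>R f) p = c *\<^sub>R dual_rmult lmult f p" for c p
    by (auto simp: dual_rmult_def para_assoc_def scaleR_fun_def oct_mult_simps algebra_simps)
  show "dual_rmult lmult f (p + q) = dual_rmult lmult f p + dual_rmult lmult f q" for p q
    by (auto simp: dual_rmult_def para_assoc_def lmult_simps oct_mult_simps linear_add[OF lin])
  show "dual_rmult lmult f (c *\<^sub>R p) = c *\<^sub>R dual_rmult lmult f p" for c p
    by (auto simp: dual_rmult_def para_assoc_def scaleR_fun_def lmult_simps oct_mult_simps
        linear_cmul[OF lin] algebra_simps)
  show "dual_rmult lmult f \<one>\<^sub>O = f"
    by (auto simp: dual_rmult_def para_assoc_def lmult_one oct_mult_one_left oct_mult_one_right)
  show "dual_rmult lmult (dual_rmult lmult f r) r = dual_rmult lmult f (r \<cdot>\<^sub>O r)" for r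
    by (rule dual_rmult_dual_rmult[OF dual_para_linear[OF f]])
  show "0 \<le> dual_norm ip f"
    by (rule dual_norm_nonneg[OF f])
  show "dual_norm ip f = 0 \<longleftrightarrow> f = 0"
    by (rule dual_norm_eq_0[OF f])
  show "dual_norm ip (c *\<^sub>R f) = \<bar>c\<bar> * dual_norm ip f" for c
    by (rule dual_norm_scaleR[OF f])
  show "dual_norm ip (dual_rmult lmult f p) = dual_norm ip f * norm p" for p
    by (rule dual_norm_dual_rmult[OF f])
  fix g assume g: "g \<in> dual"
  show "dual_rmult lmult (f + g) p = dual_rmult lmult f p + dual_rmult lmult g p" for p
    by (auto simp: dual_rmult_def para_assoc_def oct_mult_simps)
  show "dual_norm ip (f + g) \<le> dual_norm ip f + dual_norm ip g"
    using norm_add_le_dual[OF f g] dual_norm_nonneg[OF f] dual_norm_nonneg[OF g]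
    by (intro dual_norm_le) auto
qed (rule subspace_dual complete_dual)+

end

text \<open>The boundedness conjunct certifies that the supremum in \<open>dual_norm\<close> is a
  genuine least upper bound for every dual function.\<close>

theorem theorem5p3:
  fixes lmult :: "octonion \<Rightarrow> 'a::real_vector \<Rightarrow> 'a"
    and ip :: "'a \<Rightarrow> 'a \<Rightarrow> octonion"
  assumes "octonion_Hilbert_space lmult ip"
  shows "(\<forall>f\<in>dual_space lmult ip. bdd_above ((\<lambda>x. norm (f x)) ` {x. ip_norm ip x \<le> 1}))
    \<and> banach_right_octonion_module (dual_space lmult ip) (dual_rmult lmult) (dual_norm ip)"
proof -
  interpret octonion_Hilbert_space lmult ip by fact
  show ?thesis
    by (simp add: bdd_above_dual banach_right_octonion_module_dual)
qed

end
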